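(* Let $\rho:[0,+\infty)\to\mathbb{R}$ satisfy: (AS1) $\rho(0)=0$, $\rho(s)<+\infty$ for all $s<+\infty$, and $0$ is the strict minimizer of $\rho$; (AS2) $\rho$ is increasing on $[0,+\infty)$. Let $N=3M$ with $M\ge1$, let $\bar U>0$, and let $\underline u\in\mathbb{R}^N$ be the discrete gate signal $\underline u_i=\bar U$ for $M+1\le i\le2M$ and $\underline u_i=0$ otherwise. Let $\alpha>0$, let $A$ be a real $K\times N$ matrix, $f=A\underline u$, and $$E(u)=\sum_{1\le i\le N}\rho(|(\nabla_x u)_i|)+\frac{\alpha}{2}\|Au-f\|_{\mathbb{R}^K}^2,\qquad u\in\mathbb{R}^N.$$ Assume that the one-sided derivatives $\rho'(\bar U^+)$ and $\rho'(\bar U^-)$ exist and that $\rho'(\bar U^+)>0$, $\rho'(\bar U^-)>0$. Then: (1) any $u\in\mathbb{R}^N$ with higher contrast than $\underline u$ satisfies $E(u)>E(\underline u)$; (2) there always exists $u\in\mathbb{R}^N$ with lower contrast than $\underline u$ satisfying $E(u)<E(\underline u)$.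
   Context: "Increasing" is meant in the non-strict sense. $\nabla_x$ is the forward difference operator, $(\nabla_x u)_i=u_{i+1}-u_i$ for $1\le i\le N-1$, with a boundary condition at $i=N$, e.g. periodic ($(\nabla_x u)_N=u_1-u_N$) or Neumann ($(\nabla_x u)_N=0$). $\|\cdot\|_{\mathbb{R}^K}$ is the Euclidean norm. The signal $\underline u$ has two edges (between indices $M,M+1$ and between $2M,2M+1$), both with contrast $\bar U$. A signal $u$ has higher contrast than $\underline u$ if $|u_{M+1}-u_M|\ge\bar U$ and $|u_{2M+1}-u_{2M}|\ge\bar U$ with at least one strict inequality; it has lower contrast than $\underline u$ if $|u_{M+1}-u_M|\le\bar U$ and $|u_{2M+1}-u_{2M}|\le\bar U$ with at least one strict inequality. *)

theory Defs
  imports "Jordan_Normal_Form.Matrix" "HOL-Analysis.L2_Norm"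
begin

text \<open>
  Signals in \<open>\<real>\<^sup>N\<close> are vectors in \<open>carrier_vec N\<close>. Vector entries are numbered from \<open>0\<close>, so the
  component \<open>u\<^sub>i\<close> of the usual \<open>1\<close>-based numbering is \<open>u $ (i - 1)\<close>.
\<close>

text \<open>
  A boundary condition gives the last difference \<open>(\<nabla>\<^sub>x u)\<^sub>N\<close> as a function of the two end values
  \<open>u\<^sub>1\<close> and \<open>u\<^sub>N\<close>. It is homogeneous if the difference vanishes when both end values do.
\<close>

type_synonym boundary = "real \<Rightarrow> real \<Rightarrow> real"

definition homogeneous_bc :: "boundary \<Rightarrow> bool" where
  "homogeneous_bc \<beta> \<longleftrightarrow> \<beta> 0 0 = 0"

definition periodic_bc :: boundary where
  "periodic_bc = (\<lambda>u1 uN. u1 - uN)"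

definition neumann_bc :: boundary where
  "neumann_bc = (\<lambda>u1 uN. 0)"

lemma homogeneous_periodic_bc [simp]: "homogeneous_bc periodic_bc"
  by (simp add: homogeneous_bc_def periodic_bc_def)

lemma homogeneous_neumann_bc [simp]: "homogeneous_bc neumann_bc"
  by (simp add: homogeneous_bc_def neumann_bc_def)

definition forward_diff :: "boundary \<Rightarrow> real vec \<Rightarrow> real vec" where
  "forward_diff \<beta> u = vec (dim_vec u)
     (\<lambda>i. if i + 1 < dim_vec u then u $ (i + 1) - u $ i
          else \<beta> (u $ 0) (u $ (dim_vec u - 1)))"

definition euclid_norm :: "real vec \<Rightarrow> real" where
  "euclid_norm v = L2_set (\<lambda>i. v $ i) {..<dim_vec v}"

definition energy ::
    "boundary \<Rightarrow> (real \<Rightarrow> real) \<Rightarrow> real \<Rightarrow> real mat \<Rightarrow> real vec \<Rightarrow> real vec \<Rightarrow> real" where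
  "energy \<beta> \<rho> \<alpha> A f u =
     (\<Sum>i<dim_vec u. \<rho> \<bar>forward_diff \<beta> u $ i\<bar>) + \<alpha> / 2 * (euclid_norm (A *\<^sub>v u - f))\<^sup>2"

definition gate :: "nat \<Rightarrow> real \<Rightarrow> real vec" where
  "gate M U = vec (3 * M) (\<lambda>i. if M \<le> i \<and> i < 2 * M then U else 0)"

text \<open>
  The two edges of the gate are the jumps \<open>u\<^bsub>M+1\<^esub> - u\<^sub>M\<close> and \<open>u\<^bsub>2M+1\<^esub> - u\<^bsub>2M\<^esub>\<close> (\<open>1\<close>-based).
  These definitions are meant for \<open>M \<ge> 1\<close>.
\<close>

definition edge1 :: "nat \<Rightarrow> real vec \<Rightarrow> real" where
  "edge1 M u = \<bar>u $ M - u $ (M - 1)\<bar>"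

definition edge2 :: "nat \<Rightarrow> real vec \<Rightarrow> real" where
  "edge2 M u = \<bar>u $ (2 * M) - u $ (2 * M - 1)\<bar>"

definition higher_contrast :: "nat \<Rightarrow> real \<Rightarrow> real vec \<Rightarrow> bool" where
  "higher_contrast M U u \<longleftrightarrow>
     edge1 M u \<ge> U \<and> edge2 M u \<ge> U \<and> (edge1 M u > U \<or> edge2 M u > U)"

definition lower_contrast :: "nat \<Rightarrow> real \<Rightarrow> real vec \<Rightarrow> bool" where
  "lower_contrast M U u \<longleftrightarrow>
     edge1 M u \<le> U \<and> edge2 M u \<le> U \<and> (edge1 M u < U \<or> edge2 M u < U)"

end

theory Submission
  imports Defs
begin

text \<open>
  The regularizer only sees the two edges of a gate, so a gate of height \<open>s\<close> has energy
  \<open>2 * \<rho> s + c * (s - U)\<^sup>2\<close> for some constant \<open>c\<close>. Its left derivative at \<open>s = U\<close> is \<open>2 * \<rho>'(U\<^sup>-) > 0\<close>,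
  hence lowering the gate slightly lowers the energy. For a signal of higher contrast, the two edges
  alone already cost more than \<open>2 * \<rho> U\<close>, since the positive right derivative makes the increasing
  function \<open>\<rho>\<close> exceed \<open>\<rho> U\<close> everywhere to the right of \<open>U\<close>.
\<close>

text \<open>The derivative yields strict increase only on a short interval to the right of
  \<open>x\<close>; monotonicity then carries the gain to any \<open>y\<close> further away.\<close>

lemma mono_on_right_deriv_pos_less:
  fixes f :: "real \<Rightarrow> real"
  assumes "mono_on S f" and "{x..} \<subseteq> S"
    and "(f has_real_derivative d) (at_right x)" and "d > 0" and "x < y"
  shows "f x < f y"
proof -
  obtain e where e: "e > 0" "\<And>h. h > 0 \<Longrightarrow> x + h \<in> {x<..} \<Longrightarrow> h < e \<Longrightarrow> f x < f (x + h)"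
    using has_real_derivative_pos_inc_right[OF assms(3,4)] by blast
  define h where "h = min (e / 2) (y - x)"
  have h: "h > 0" "h < e" "x + h \<le> y"
    using e(1) \<open>x < y\<close> by (auto simp: h_def)
  have "f x < f (x + h)"
    using e(2) h by simp
  also have "\<dots> \<le> f y"
    using assms(2) h \<open>x < y\<close> by (intro mono_onD[OF assms(1)]) auto
  finally show ?thesis .
qed

lemma sum_forward_diff_ge_edges:
  fixes \<rho> :: "real \<Rightarrow> real"
  assumes "u \<in> carrier_vec (3 * M)" and "M \<ge> 1" and "\<And>s. s \<ge> 0 \<Longrightarrow> \<rho> s \<ge> 0"
  shows "\<rho> (edge1 M u) + \<rho> (edge2 M u) \<le> (\<Sum>i<dim_vec u. \<rho> \<bar>forward_diff \<beta> u $ i\<bar>)"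
proof -
  \<comment> \<open>As \<open>M \<ge> 1\<close>, the two indices are distinct and both lie below the
    last one, so neither term involves \<open>\<beta>\<close>.\<close>
  have "\<rho> (edge1 M u) + \<rho> (edge2 M u) = (\<Sum>i\<in>{M - 1, 2 * M - 1}. \<rho> \<bar>forward_diff \<beta> u $ i\<bar>)"
    using assms(1,2) by (auto simp: edge1_def edge2_def forward_diff_def)
  also have "\<dots> \<le> (\<Sum>i<dim_vec u. \<rho> \<bar>forward_diff \<beta> u $ i\<bar>)"
    using assms(1,2) by (intro sum_mono2 assms(3)) auto
  finally show ?thesis .
qed

lemma gate_carrier [simp]: "gate M s \<in> carrier_vec (3 * M)"
  by (simp add: gate_def)

lemma gate_eq_smult: "gate M s = s \<cdot>\<^sub>v gate M 1"
  by (rule eq_vecI) (auto simp: gate_def)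

lemma edge_gate:
  assumes "M \<ge> 1"
  shows "edge1 M (gate M s) = \<bar>s\<bar>" and "edge2 M (gate M s) = \<bar>s\<bar>"
  using assms by (auto simp: edge1_def edge2_def gate_def)

text \<open>A gate vanishes at both end indices, so a homogeneous boundary condition makes the last
  difference zero and only the two jumps remain.\<close>

lemma sum_forward_diff_gate:
  fixes \<rho> :: "real \<Rightarrow> real"
  assumes "M \<ge> 1" and "homogeneous_bc \<beta>" and "\<rho> 0 = 0"
  shows "(\<Sum>i<dim_vec (gate M s). \<rho> \<bar>forward_diff \<beta> (gate M s) $ i\<bar>) = 2 * \<rho> \<bar>s\<bar>"
proof -
  have "(\<Sum>i<dim_vec (gate M s). \<rho> \<bar>forward_diff \<beta> (gate M s) $ i\<bar>)
      = (\<Sum>i\<in>{M - 1, 2 * M - 1}. \<rho> \<bar>s\<bar>)"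
    using assms
    by (intro sum.mono_neutral_cong_right)
       (auto simp: gate_def forward_diff_def homogeneous_bc_def)
  also have "\<dots> = 2 * \<rho> \<bar>s\<bar>"
    using assms(1) by (subst sum_constant) (simp add: card_insert_if)
  finally show ?thesis .
qed

lemma euclid_norm_smult: "euclid_norm (c \<cdot>\<^sub>v v) = \<bar>c\<bar> * euclid_norm v"
  by (simp add: euclid_norm_def L2_set_def power_mult_distrib real_sqrt_mult
      flip: sum_distrib_left)

lemma energy_gate:
  assumes "M \<ge> 1" and "homogeneous_bc \<beta>" and "\<rho> 0 = 0" and "A \<in> carrier_mat K (3 * M)"
  shows "energy \<beta> \<rho> \<alpha> A (A *\<^sub>v gate M U) (gate M s)
    = 2 * \<rho> \<bar>s\<bar> + \<alpha> / 2 * ((s - U)\<^sup>2 * (euclid_norm (A *\<^sub>v gate M 1))\<^sup>2)"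
proof -
  have scale: "A *\<^sub>v gate M t = t \<cdot>\<^sub>v (A *\<^sub>v gate M 1)" for t
    using assms(4) by (subst gate_eq_smult) (rule mult_mat_vec, auto)
  \<comment> \<open>All gates are multiples of the unit gate, so the residual is a multiple of one
    fixed vector and its squared norm is quadratic in \<open>s - U\<close>.\<close>
  have "A *\<^sub>v gate M s - A *\<^sub>v gate M U = (s - U) \<cdot>\<^sub>v (A *\<^sub>v gate M 1)"
    unfolding scale[of s] scale[of U] by (rule eq_vecI) (auto simp: left_diff_distrib)
  then show ?thesis
    using assms by (simp add: energy_def sum_forward_diff_gate euclid_norm_smult power_mult_distrib)
qed

theorem proposition4p4:
  fixes \<rho> :: "real \<Rightarrow> real" and M N K :: nat and U \<alpha> dplus dminus :: real
    and A :: "real mat" and f :: "real vec" and \<beta> :: boundary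
  assumes rho_zero: "\<rho> 0 = 0"
    and rho_strict_min: "\<forall>s>0. \<rho> 0 < \<rho> s"
    and rho_increasing: "mono_on {0..} \<rho>"
    and N: "N = 3 * M" and M: "M \<ge> 1" and U: "U > 0" and alpha: "\<alpha> > 0"
    and A: "A \<in> carrier_mat K N"
    and f: "f = A *\<^sub>v gate M U"
    and bc: "homogeneous_bc \<beta>"
    and right_deriv: "(\<rho> has_real_derivative dplus) (at_right U)" and "dplus > 0"
    and left_deriv: "(\<rho> has_real_derivative dminus) (at_left U)" and "dminus > 0"
  shows "(\<forall>u \<in> carrier_vec N. higher_contrast M U u \<longrightarrow>
            energy \<beta> \<rho> \<alpha> A f u > energy \<beta> \<rho> \<alpha> A f (gate M U))
       \<and> (\<exists>u \<in> carrier_vec N. lower_contrast M U u \<and>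
            energy \<beta> \<rho> \<alpha> A f u < energy \<beta> \<rho> \<alpha> A f (gate M U))"
proof (intro conjI ballI impI)
  note M3 = A[unfolded N]
  have nonneg: "\<rho> s \<ge> 0" if "s \<ge> 0" for s
    using mono_onD[OF rho_increasing, of 0 s] that rho_zero by simp
  have gate_energy: "energy \<beta> \<rho> \<alpha> A f (gate M s)
      = 2 * \<rho> \<bar>s\<bar> + \<alpha> / 2 * ((s - U)\<^sup>2 * (euclid_norm (A *\<^sub>v gate M 1))\<^sup>2)" for s
    unfolding f by (rule energy_gate[where \<rho> = \<rho>, OF M bc rho_zero M3])

  show "energy \<beta> \<rho> \<alpha> A f u > energy \<beta> \<rho> \<alpha> A f (gate M U)"
    if u: "u \<in> carrier_vec N" and high: "higher_contrast M U u" for u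
  proof -
    have "{U..} \<subseteq> {0..}"
      using U by auto
    then have "\<rho> U < \<rho> s" if "U < s" for s
      using mono_on_right_deriv_pos_less[OF rho_increasing _ right_deriv \<open>dplus > 0\<close> that] by blast
    \<comment> \<open>An edge equal to \<open>U\<close> costs exactly \<open>\<rho> U\<close>, a
      larger one strictly more, and at least one is larger.\<close>
    then have "2 * \<rho> U < \<rho> (edge1 M u) + \<rho> (edge2 M u)"
      using high unfolding higher_contrast_def by (smt (verit))
    also have "\<dots> \<le> energy \<beta> \<rho> \<alpha> A f u"
      unfolding energy_def using sum_forward_diff_ge_edges[of u M \<rho> \<beta>] u N M nonneg alpha
      by (intro add_increasing2) auto
    finally show ?thesis
      using U by (simp add: gate_energy)
  qed

  let ?g = "\<lambda>s. 2 * \<rho> s + \<alpha> / 2 * ((s - U)\<^sup>2 * (euclid_norm (A *\<^sub>v gate M 1))\<^sup>2)"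
  \<comment> \<open>The quadratic term has derivative zero at \<open>U\<close>, so only
    \<open>2 * \<rho> s\<close> contributes.\<close>
  have "(?g has_real_derivative 2 * dminus) (at_left U)"
    by (auto intro!: derivative_eq_intros left_deriv)
  then obtain e where e: "e > 0"
    "\<And>h. h > 0 \<Longrightarrow> U - h \<in> {..<U} \<Longrightarrow> h < e \<Longrightarrow> ?g (U - h) < ?g U"
    using has_real_derivative_pos_inc_left[of ?g "2 * dminus" U "{..<U}"] \<open>dminus > 0\<close> by auto
  \<comment> \<open>Halving \<open>e\<close> gives \<open>h < e\<close>. The bound by
    \<open>U\<close> keeps \<open>U - h\<close> nonnegative, so that \<open>?g\<close>, written
    without absolute value, is the energy of the lowered gate.\<close>
  define h where "h = min (e / 2) U"
  have h: "h > 0" "h < e" "h \<le> U"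
    using e(1) U by (auto simp: h_def)
  then have "energy \<beta> \<rho> \<alpha> A f (gate M (U - h)) < energy \<beta> \<rho> \<alpha> A f (gate M U)"
    using e(2)[of h] U by (simp add: gate_energy)
  moreover have "lower_contrast M U (gate M (U - h))"
    using h by (simp add: lower_contrast_def edge_gate[OF M])
  ultimately show "\<exists>u \<in> carrier_vec N. lower_contrast M U u \<and>
      energy \<beta> \<rho> \<alpha> A f u < energy \<beta> \<rho> \<alpha> A f (gate M U)"
    unfolding N using gate_carrier by blast
qed

end
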